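(* Let $h:\mathbb{R}^n\to\mathbb{R}\cup\{\pm\infty\}$ be a proper function. Then the following implications hold, both in the non-strong versions and in the strong versions (i.e. with "strongly" inserted throughout an implication): 1. if $\operatorname{argmin}_{\mathbb{R}^n}h\ne\emptyset$, (strongly) convex $\Rightarrow$ (strongly) star-convex; 2. (strongly) star-convex $\Rightarrow$ (strongly) quasar-convex; 3. (strongly) convex $\Rightarrow$ (strongly) quasiconvex; 4. if $\operatorname{argmin}_{\mathbb{R}^n}h\ne\emptyset$, (strongly) quasiconvex $\Rightarrow$ (strongly) star quasiconvex; 5. (strongly) star-convex $\Rightarrow$ (strongly) star quasiconvex; 6. (strongly) quasar-convex $\Rightarrow$ (strongly) star quasiconvex. In the implications, the star-type properties refer to a minimizer $\overline{x}\in\operatorname{argmin}_{\mathbb{R}^n}h$: in 1 and 4 the conclusion holds with respect to any minimizer, and in 2, 5, 6 the hypothesis and the conclusion refer to the same minimizer.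
   Context: $h$ is proper if $\operatorname{dom}h:=\{x: h(x)<+\infty\}\ne\emptyset$ and $h>-\infty$ everywhere. In each definition below the non-strong notion is the case $\gamma=0$ and the strong notion means that the inequality holds for some $\gamma>0$ (the constants need not be preserved by the implications). (Strongly) convex: $\operatorname{dom}h$ is convex and for all $x,y\in\operatorname{dom}h$, $\lambda\in[0,1]$: $h(\lambda y+(1-\lambda)x)\le\lambda h(y)+(1-\lambda)h(x)-\lambda(1-\lambda)\frac{\gamma}{2}\|x-y\|^2$. (Strongly) quasiconvex: $\operatorname{dom}h$ is convex and for all $x,y\in\operatorname{dom}h$, $\lambda\in[0,1]$: $h(\lambda y+(1-\lambda)x)\le\max\{h(y),h(x)\}-\lambda(1-\lambda)\frac{\gamma}{2}\|x-y\|^2$. For the following, $\overline{x}\in\operatorname{argmin}_{\mathbb{R}^n}h$ (set of global minimizers), and the inequality is required for all $y\in\operatorname{dom}h$ and $\lambda\in[0,1]$. (Strongly) star-convex: $h(\lambda\overline{x}+(1-\lambda)y)\le\lambda h(\overline{x})+(1-\lambda)h(y)-\lambda(1-\lambda)\frac{\gamma}{2}\|y-\overline{x}\|^2$. (Strongly) quasar-convex: there is $\beta\in\,]0,1]$ such that $h(\lambda\overline{x}+(1-\lambda)y)\le\lambda\beta h(\overline{x})+(1-\lambda\beta)h(y)-\lambda\big(1-\frac{\lambda}{2-\beta}\big)\frac{\beta\gamma}{2}\|y-\overline{x}\|^2$. (Strongly) star quasiconvex: $h(\lambda\overline{x}+(1-\lambda)y)\le h(y)-\lambda(1-\lambda)\frac{\gamma}{2}\|y-\overline{x}\|^2$.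 *)

theory Defs
  imports "HOL-Analysis.Analysis"
begin

definition edom :: "('a \<Rightarrow> ereal) \<Rightarrow> 'a set" where
  "edom h = {x. h x < \<infinity>}"

definition proper :: "('a \<Rightarrow> ereal) \<Rightarrow> bool" where
  "proper h \<longleftrightarrow> edom h \<noteq> {} \<and> (\<forall>x. h x > -\<infinity>)"

definition argmin :: "('a \<Rightarrow> ereal) \<Rightarrow> 'a set" where
  "argmin h = {x. \<forall>y. h x \<le> h y}"

text \<open>
  The predicates below with suffix \<open>_mod\<close> carry the modulus \<open>\<gamma>\<close>. They are meant for proper
  functions: all values of \<open>h\<close> on the right-hand sides are then finite, so that no
  indeterminate sum or difference of extended reals occurs.
\<close>

definition convex_mod :: "real \<Rightarrow> ('a::real_normed_vector \<Rightarrow> ereal) \<Rightarrow> bool" where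
  "convex_mod \<gamma> h \<longleftrightarrow> convex (edom h) \<and>
     (\<forall>x\<in>edom h. \<forall>y\<in>edom h. \<forall>l\<in>{0..1}.
        h (l *\<^sub>R y + (1 - l) *\<^sub>R x)
          \<le> ereal l * h y + ereal (1 - l) * h x
             - ereal (l * (1 - l) * (\<gamma> / 2) * (norm (x - y))\<^sup>2))"

definition quasiconvex_mod :: "real \<Rightarrow> ('a::real_normed_vector \<Rightarrow> ereal) \<Rightarrow> bool" where
  "quasiconvex_mod \<gamma> h \<longleftrightarrow> convex (edom h) \<and>
     (\<forall>x\<in>edom h. \<forall>y\<in>edom h. \<forall>l\<in>{0..1}.
        h (l *\<^sub>R y + (1 - l) *\<^sub>R x)
          \<le> max (h y) (h x) - ereal (l * (1 - l) * (\<gamma> / 2) * (norm (x - y))\<^sup>2))"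

definition star_convex_mod :: "real \<Rightarrow> ('a::real_normed_vector \<Rightarrow> ereal) \<Rightarrow> 'a \<Rightarrow> bool" where
  "star_convex_mod \<gamma> h xb \<longleftrightarrow> xb \<in> argmin h \<and>
     (\<forall>y\<in>edom h. \<forall>l\<in>{0..1}.
        h (l *\<^sub>R xb + (1 - l) *\<^sub>R y)
          \<le> ereal l * h xb + ereal (1 - l) * h y
             - ereal (l * (1 - l) * (\<gamma> / 2) * (norm (y - xb))\<^sup>2))"

definition quasar_convex_mod :: "real \<Rightarrow> ('a::real_normed_vector \<Rightarrow> ereal) \<Rightarrow> 'a \<Rightarrow> bool" where
  "quasar_convex_mod \<gamma> h xb \<longleftrightarrow> xb \<in> argmin h \<and>
     (\<exists>\<beta>\<in>{0<..1}. \<forall>y\<in>edom h. \<forall>l\<in>{0..1}.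
        h (l *\<^sub>R xb + (1 - l) *\<^sub>R y)
          \<le> ereal (l * \<beta>) * h xb + ereal (1 - l * \<beta>) * h y
             - ereal (l * (1 - l / (2 - \<beta>)) * (\<beta> * \<gamma> / 2) * (norm (y - xb))\<^sup>2))"

definition star_quasiconvex_mod :: "real \<Rightarrow> ('a::real_normed_vector \<Rightarrow> ereal) \<Rightarrow> 'a \<Rightarrow> bool" where
  "star_quasiconvex_mod \<gamma> h xb \<longleftrightarrow> xb \<in> argmin h \<and>
     (\<forall>y\<in>edom h. \<forall>l\<in>{0..1}.
        h (l *\<^sub>R xb + (1 - l) *\<^sub>R y)
          \<le> h y - ereal (l * (1 - l) * (\<gamma> / 2) * (norm (y - xb))\<^sup>2))"

definition convex_fun :: "('a::real_normed_vector \<Rightarrow> ereal) \<Rightarrow> bool" where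
  "convex_fun h \<longleftrightarrow> convex_mod 0 h"

definition strongly_convex :: "('a::real_normed_vector \<Rightarrow> ereal) \<Rightarrow> bool" where
  "strongly_convex h \<longleftrightarrow> (\<exists>\<gamma>>0. convex_mod \<gamma> h)"

definition quasiconvex :: "('a::real_normed_vector \<Rightarrow> ereal) \<Rightarrow> bool" where
  "quasiconvex h \<longleftrightarrow> quasiconvex_mod 0 h"

definition strongly_quasiconvex :: "('a::real_normed_vector \<Rightarrow> ereal) \<Rightarrow> bool" where
  "strongly_quasiconvex h \<longleftrightarrow> (\<exists>\<gamma>>0. quasiconvex_mod \<gamma> h)"

definition star_convex :: "('a::real_normed_vector \<Rightarrow> ereal) \<Rightarrow> 'a \<Rightarrow> bool" where
  "star_convex h xb \<longleftrightarrow> star_convex_mod 0 h xb"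

definition strongly_star_convex :: "('a::real_normed_vector \<Rightarrow> ereal) \<Rightarrow> 'a \<Rightarrow> bool" where
  "strongly_star_convex h xb \<longleftrightarrow> (\<exists>\<gamma>>0. star_convex_mod \<gamma> h xb)"

definition quasar_convex :: "('a::real_normed_vector \<Rightarrow> ereal) \<Rightarrow> 'a \<Rightarrow> bool" where
  "quasar_convex h xb \<longleftrightarrow> quasar_convex_mod 0 h xb"

definition strongly_quasar_convex :: "('a::real_normed_vector \<Rightarrow> ereal) \<Rightarrow> 'a \<Rightarrow> bool" where
  "strongly_quasar_convex h xb \<longleftrightarrow> (\<exists>\<gamma>>0. quasar_convex_mod \<gamma> h xb)"

definition star_quasiconvex :: "('a::real_normed_vector \<Rightarrow> ereal) \<Rightarrow> 'a \<Rightarrow> bool" where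
  "star_quasiconvex h xb \<longleftrightarrow> star_quasiconvex_mod 0 h xb"

definition strongly_star_quasiconvex :: "('a::real_normed_vector \<Rightarrow> ereal) \<Rightarrow> 'a \<Rightarrow> bool" where
  "strongly_star_quasiconvex h xb \<longleftrightarrow> (\<exists>\<gamma>>0. star_quasiconvex_mod \<gamma> h xb)"

end

theory Submission
  imports Defs
begin

text \<open>All implications are pointwise comparisons of right-hand sides, with the modulus tracked
  explicitly: the plain versions are the case \<open>\<gamma> = 0\<close>, and the strong ones need
  the new modulus to be positive. Properness puts minimizers into the domain and makes the values
  there real. Passing to a star-type notion is then a specialization of one endpoint to the
  minimizer, and star-convexity is quasar-convexity with \<open>\<beta> = 1\<close>. The quasi-type
  conclusions rest on one estimate, \<open>convex_combination_minus_le\<close>: an average of two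
  values is at most any common upper bound. For quasar-convexity the weights
  \<open>l * \<beta>\<close> and \<open>1 - l * \<beta>\<close> are still convex, so the average is
  at most \<open>h y\<close>, at the price of the modulus \<open>\<beta> * \<gamma>\<close>.\<close>

lemma proper_finite:
  assumes "proper h" "x \<in> edom h"
  obtains r where "h x = ereal r"
  using assms by (cases "h x") (auto simp: proper_def edom_def)

text \<open>The minimal value lies below the finite value at some point of the domain. Hence a
  minimizer is an admissible endpoint in inequalities quantified over \<open>edom h\<close>.\<close>

lemma argmin_subset_edom:
  assumes "proper h"
  shows "argmin h \<subseteq> edom h"
proof
  fix x assume x: "x \<in> argmin h"
  obtain y where "y \<in> edom h" using assms by (auto simp: proper_def)
  with x show "x \<in> edom h"
    by (auto simp: argmin_def edom_def intro: le_less_trans)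
qed

text \<open>The shared estimate, over reals so that no infinite value interferes. The slack between
  \<open>d\<close> and \<open>c\<close> serves the quasar case, where the quadratic term changes as
  well.\<close>

lemma convex_combination_minus_le:
  fixes a b m c d t :: real
  assumes "a \<le> m" "b \<le> m" "0 \<le> t" "t \<le> 1" "d \<le> c"
  shows "ereal t * ereal a + ereal (1 - t) * ereal b - ereal c \<le> ereal m - ereal d"
  using convex_bound_le[of a m b t "1 - t"] assms by simp

lemma convex_mod_imp_star_convex_mod:
  assumes "proper h" "convex_mod \<gamma> h" "xb \<in> argmin h"
  shows "star_convex_mod \<gamma> h xb"
  using assms argmin_subset_edom[of h]
  unfolding convex_mod_def star_convex_mod_def by blast

lemma convex_mod_imp_quasiconvex_mod:
  assumes h: "proper h" and cvx: "convex_mod \<gamma> h"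
  shows "quasiconvex_mod \<gamma> h"
  unfolding quasiconvex_mod_def
proof (intro conjI ballI)
  show "convex (edom h)" using cvx by (simp add: convex_mod_def)
  fix x y and l :: real
  assume x: "x \<in> edom h" and y: "y \<in> edom h" and l: "l \<in> {0..1}"
  let ?c = "l * (1 - l) * (\<gamma> / 2) * (norm (x - y))\<^sup>2"
  obtain p where p: "h x = ereal p" using proper_finite[OF h x] .
  obtain q where q: "h y = ereal q" using proper_finite[OF h y] .
  have "h (l *\<^sub>R y + (1 - l) *\<^sub>R x) \<le> ereal l * h y + ereal (1 - l) * h x - ereal ?c"
    using cvx x y l unfolding convex_mod_def by blast
  also have "\<dots> \<le> ereal (max q p) - ereal ?c"
    unfolding p q by (rule convex_combination_minus_le) (use l in auto)
  also have "ereal (max q p) = max (h y) (h x)"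
    by (simp add: p q)
  finally show "h (l *\<^sub>R y + (1 - l) *\<^sub>R x) \<le> max (h y) (h x) - ereal ?c" .
qed

text \<open>With the minimizer as one endpoint, the maximum collapses to the value at the
  other.\<close>

lemma quasiconvex_mod_imp_star_quasiconvex_mod:
  assumes "proper h" "quasiconvex_mod \<gamma> h" "xb \<in> argmin h"
  shows "star_quasiconvex_mod \<gamma> h xb"
  unfolding star_quasiconvex_mod_def
proof (intro conjI ballI)
  fix y and l :: real
  assume "y \<in> edom h" "l \<in> {0..1}"
  moreover have "max (h xb) (h y) = h y"
    using assms(3) by (simp add: argmin_def max_def)
  moreover have "xb \<in> edom h" using assms argmin_subset_edom by blast
  ultimately show "h (l *\<^sub>R xb + (1 - l) *\<^sub>R y)
      \<le> h y - ereal (l * (1 - l) * (\<gamma> / 2) * (norm (y - xb))\<^sup>2)"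
    using assms(2) unfolding quasiconvex_mod_def by metis
qed (fact assms)

text \<open>For \<open>\<beta> = 1\<close> one has \<open>2 - \<beta> = 1\<close>, and the two
  inequalities coincide.\<close>

lemma star_convex_mod_imp_quasar_convex_mod:
  assumes "star_convex_mod \<gamma> h xb"
  shows "quasar_convex_mod \<gamma> h xb"
  using assms unfolding star_convex_mod_def quasar_convex_mod_def
  by (intro conjI bexI[of _ 1]) auto

text \<open>Since \<open>2 - \<beta> \<ge> 1\<close>, the factor \<open>1 - l / (2 - \<beta>)\<close> dominates \<open>1 - l\<close>, so that \<open>\<beta> * \<gamma>\<close>
  is a modulus of star quasiconvexity.\<close>

lemma quasar_convex_mod_imp_star_quasiconvex_mod:
  assumes h: "proper h" and "0 \<le> \<gamma>" and qc: "quasar_convex_mod \<gamma> h xb"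
  obtains \<beta> where "0 < \<beta>" "star_quasiconvex_mod (\<beta> * \<gamma>) h xb"
proof -
  have xb: "xb \<in> argmin h" using qc by (simp add: quasar_convex_mod_def)
  obtain \<beta> where \<beta>: "0 < \<beta>" "\<beta> \<le> 1"
    and ineq: "\<And>y l. y \<in> edom h \<Longrightarrow> l \<in> {0..1} \<Longrightarrow> h (l *\<^sub>R xb + (1 - l) *\<^sub>R y)
      \<le> ereal (l * \<beta>) * h xb + ereal (1 - l * \<beta>) * h y
         - ereal (l * (1 - l / (2 - \<beta>)) * (\<beta> * \<gamma> / 2) * (norm (y - xb))\<^sup>2)"
    using qc unfolding quasar_convex_mod_def by auto
  have "star_quasiconvex_mod (\<beta> * \<gamma>) h xb"
    unfolding star_quasiconvex_mod_def
  proof (intro conjI ballI)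
    fix y and l :: real
    assume y: "y \<in> edom h" and l: "l \<in> {0..1}"
    let ?c = "l * (1 - l / (2 - \<beta>)) * (\<beta> * \<gamma> / 2) * (norm (y - xb))\<^sup>2"
    let ?d = "l * (1 - l) * (\<beta> * \<gamma> / 2) * (norm (y - xb))\<^sup>2"
    obtain p where p: "h xb = ereal p"
      using proper_finite[OF h] xb argmin_subset_edom[OF h] by blast
    obtain q where q: "h y = ereal q" using proper_finite[OF h y] .
    have "p \<le> q" using xb p q by (metis (lifting) argmin_def ereal_less_eq(3) mem_Collect_eq)
    have "l / (2 - \<beta>) \<le> l" using l \<beta> mult_left_mono[of 1 "2 - \<beta>" l] by (simp add: divide_le_eq)
    \<comment> \<open>The comparison of \<open>1 - l\<close> with
      \<open>1 - l / (2 - \<beta>)\<close> survives scaling because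
      \<open>\<beta> * \<gamma> / 2\<close> is nonnegative.\<close>
    then have "?d \<le> ?c"
      using l \<beta> \<open>0 \<le> \<gamma>\<close> by (intro mult_right_mono mult_left_mono) auto
    have "h (l *\<^sub>R xb + (1 - l) *\<^sub>R y)
        \<le> ereal (l * \<beta>) * h xb + ereal (1 - l * \<beta>) * h y - ereal ?c"
      by (rule ineq[OF y l])
    \<comment> \<open>The weight is \<open>t = l * \<beta>\<close>, which lies in the unit interval,
      and the common bound of \<open>p\<close> and \<open>q\<close> is \<open>q\<close>.\<close>
    also have "\<dots> \<le> ereal q - ereal ?d"
      unfolding p q
      by (rule convex_combination_minus_le)
        (use l \<beta> \<open>p \<le> q\<close> \<open>?d \<le> ?c\<close> in \<open>auto intro: mult_le_one\<close>)
    finally show "h (l *\<^sub>R xb + (1 - l) *\<^sub>R y) \<le> h y - ereal ?d"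
      by (simp add: q)
  qed (fact xb)
  with \<beta> show thesis using that by blast
qed

lemma quasar_convex_imp_star_quasiconvex:
  assumes "proper h" "quasar_convex h xb"
  shows "star_quasiconvex h xb"
  using quasar_convex_mod_imp_star_quasiconvex_mod[of h 0 xb] assms
  by (auto simp: quasar_convex_def star_quasiconvex_def)

text \<open>The modulus shrinks to \<open>\<beta> * \<gamma>\<close>, which is still
  positive.\<close>

lemma strongly_quasar_convex_imp_strongly_star_quasiconvex:
  assumes "proper h" "strongly_quasar_convex h xb"
  shows "strongly_star_quasiconvex h xb"
proof -
  obtain \<gamma> where \<gamma>: "0 < \<gamma>" "quasar_convex_mod \<gamma> h xb"
    using assms(2) by (auto simp: strongly_quasar_convex_def)
  then obtain \<beta> where "0 < \<beta>" "star_quasiconvex_mod (\<beta> * \<gamma>) h xb"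
    using quasar_convex_mod_imp_star_quasiconvex_mod[OF assms(1), of \<gamma> xb] by auto
  with \<gamma>(1) show ?thesis
    unfolding strongly_star_quasiconvex_def by (meson mult_pos_pos)
qed

theorem proposition5:
  fixes h :: "real ^ 'n \<Rightarrow> ereal"
  assumes "proper h"
  shows
    "(argmin h \<noteq> {} \<longrightarrow> convex_fun h \<longrightarrow> (\<forall>xb\<in>argmin h. star_convex h xb)) \<and>
     (argmin h \<noteq> {} \<longrightarrow> strongly_convex h \<longrightarrow> (\<forall>xb\<in>argmin h. strongly_star_convex h xb)) \<and>
     (\<forall>xb\<in>argmin h. star_convex h xb \<longrightarrow> quasar_convex h xb) \<and>
     (\<forall>xb\<in>argmin h. strongly_star_convex h xb \<longrightarrow> strongly_quasar_convex h xb) \<and>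
     (convex_fun h \<longrightarrow> quasiconvex h) \<and>
     (strongly_convex h \<longrightarrow> strongly_quasiconvex h) \<and>
     (argmin h \<noteq> {} \<longrightarrow> quasiconvex h \<longrightarrow> (\<forall>xb\<in>argmin h. star_quasiconvex h xb)) \<and>
     (argmin h \<noteq> {} \<longrightarrow> strongly_quasiconvex h \<longrightarrow>
        (\<forall>xb\<in>argmin h. strongly_star_quasiconvex h xb)) \<and>
     (\<forall>xb\<in>argmin h. star_convex h xb \<longrightarrow> star_quasiconvex h xb) \<and>
     (\<forall>xb\<in>argmin h. strongly_star_convex h xb \<longrightarrow> strongly_star_quasiconvex h xb) \<and>
     (\<forall>xb\<in>argmin h. quasar_convex h xb \<longrightarrow> star_quasiconvex h xb) \<and>
     (\<forall>xb\<in>argmin h. strongly_quasar_convex h xb \<longrightarrow> strongly_star_quasiconvex h xb)"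
proof (intro conjI impI ballI)
  fix xb assume xb: "xb \<in> argmin h"
  show "star_convex h xb" if "convex_fun h"
    using that convex_mod_imp_star_convex_mod[OF assms _ xb]
    by (auto simp: convex_fun_def star_convex_def)
  show "strongly_star_convex h xb" if "strongly_convex h"
    using that convex_mod_imp_star_convex_mod[OF assms _ xb]
    by (auto simp: strongly_convex_def strongly_star_convex_def)
  show "star_quasiconvex h xb" if "quasiconvex h"
    using that quasiconvex_mod_imp_star_quasiconvex_mod[OF assms _ xb]
    by (auto simp: quasiconvex_def star_quasiconvex_def)
  show "strongly_star_quasiconvex h xb" if "strongly_quasiconvex h"
    using that quasiconvex_mod_imp_star_quasiconvex_mod[OF assms _ xb]
    by (auto simp: strongly_quasiconvex_def strongly_star_quasiconvex_def)
  have star_quasar: "quasar_convex h xb" if "star_convex h xb"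
    using that star_convex_mod_imp_quasar_convex_mod
    by (auto simp: star_convex_def quasar_convex_def)
  have strongly_star_quasar: "strongly_quasar_convex h xb" if "strongly_star_convex h xb"
    using that star_convex_mod_imp_quasar_convex_mod
    by (auto simp: strongly_star_convex_def strongly_quasar_convex_def)
  show "quasar_convex h xb" if "star_convex h xb"
    using that by (rule star_quasar)
  show "strongly_quasar_convex h xb" if "strongly_star_convex h xb"
    using that by (rule strongly_star_quasar)
  show "star_quasiconvex h xb" if "quasar_convex h xb"
    using assms that by (rule quasar_convex_imp_star_quasiconvex)
  show "strongly_star_quasiconvex h xb" if "strongly_quasar_convex h xb"
    using assms that by (rule strongly_quasar_convex_imp_strongly_star_quasiconvex)
  \<comment> \<open>Star-convexity reaches star quasiconvexity by way of quasar-convexity, in the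
    plain and the strong version alike.\<close>
  show "star_quasiconvex h xb" if "star_convex h xb"
    using assms star_quasar[OF that] by (rule quasar_convex_imp_star_quasiconvex)
  show "strongly_star_quasiconvex h xb" if "strongly_star_convex h xb"
    using assms strongly_star_quasar[OF that]
    by (rule strongly_quasar_convex_imp_strongly_star_quasiconvex)
next
  show "quasiconvex h" if "convex_fun h"
    using that convex_mod_imp_quasiconvex_mod[OF assms]
    by (auto simp: convex_fun_def quasiconvex_def)
  show "strongly_quasiconvex h" if "strongly_convex h"
    using that convex_mod_imp_quasiconvex_mod[OF assms]
    by (auto simp: strongly_convex_def strongly_quasiconvex_def)
qed

end
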